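(* Let $(A,\alpha,\mu)$ be a Hom-associative algebra, with $\mu(a\otimes b)=a\cdot b$, and let $(r,s)$ be a Hom-Yang-Baxter pair, with $r=r_{(1)}\otimes r_{(2)}$ and $s=s_{(1)}\otimes s_{(2)}$ (summation understood). Define $R,S:A\to A$ by $$R(a):=(r_{(1)}\cdot a)\cdot\alpha(r_{(2)})=\alpha(r_{(1)})\cdot(a\cdot r_{(2)}),\qquad S(a):=(s_{(1)}\cdot a)\cdot\alpha(s_{(2)})=\alpha(s_{(1)})\cdot(a\cdot s_{(2)}).$$ Then $(R,S)$ is an $(\alpha^2)$-Rota-Baxter system on the Hom-associative algebra $(A,\alpha,\mu)$.
   Context: All vector spaces, linear maps and tensor products are over a field $\mathbb{K}$. A (multiplicative) Hom-associative algebra $(A,\alpha,\mu)$ is a vector space $A$ with a linear map $\alpha:A\to A$ and a bilinear map $\mu:A\otimes A\to A$, $a\otimes b\mapsto a\cdot b$, such that $(a\cdot b)\cdot\alpha(c)=\alpha(a)\cdot(b\cdot c)$ and $\alpha(a\cdot b)=\alpha(a)\cdot\alpha(b)$ for all $a,b,c\in A$. All Hom-associative algebras are assumed multiplicative. Elements of $A^{\otimes 2}$ are written $r=r_{(1)}\otimes r_{(2)}$ with the (finite) summation sign suppressed. An element $r\in A^{\otimes 2}$ is $\alpha$-invariant if $(\alpha\otimes\alpha)(r)=r$. For $\alpha$-invariant $r,s\in A^{\otimes 2}$ define elements of $A^{\otimes 3}$ by $$r_{13}s_{12}=r_{(1)}\cdot s_{(1)}\otimes\alpha(s_{(2)})\otimes\alpha(r_{(2)}),$$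 $$r_{12}s_{23}=\alpha(r_{(1)})\otimes r_{(2)}\cdot s_{(1)}\otimes\alpha(s_{(2)}),$$ $$r_{23}s_{13}=\alpha(s_{(1)})\otimes\alpha(r_{(1)})\otimes r_{(2)}\cdot s_{(2)}$$ (the same formulas are used when both elements coincide, with two independent copies). A pair $(r,s)$ of $\alpha$-invariant elements of $A^{\otimes 2}$ is a Hom-Yang-Baxter pair if $$r_{13}r_{12}-r_{12}r_{23}+s_{23}r_{13}=0,\qquad s_{13}r_{12}-s_{12}s_{23}+s_{23}s_{13}=0.$$ For $n\ge 0$, an $(\alpha^n)$-Rota-Baxter system on $(A,\alpha,\mu)$ is a pair $(R,S)$ of linear maps $A\to A$ with $\alpha\circ R=R\circ\alpha$, $\alpha\circ S=S\circ\alpha$ and, for all $a,b\in A$, $$R(\alpha^n(a))\cdot R(\alpha^n(b))=R\big(R(a)\cdot\alpha^n(b)+\alpha^n(a)\cdot S(b)\big),$$ $$S(\alpha^n(a))\cdot S(\alpha^n(b))=S\big(R(a)\cdot\alpha^n(b)+\alpha^n(a)\cdot S(b)\big).$$ *)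

theory Defs
  imports Complex_Main "HOL-Library.Poly_Mapping"
begin

section \<open>Tensor square and tensor cube of a vector space\<close>

text \<open>
  A vector space is given, as in the library locale, by its scalar multiplication
  \<open>scale\<close> on a type. The spaces \<open>A \<otimes> A\<close> and \<open>A \<otimes> A \<otimes> A\<close> are constructed
  as the quotients of the free vector spaces on \<open>A \<times> A\<close> and \<open>A \<times> A \<times> A\<close> by the subspaces
  of bilinear and trilinear relations. Since these subspaces depend on the term \<open>scale\<close>, the
  quotients are not types, and a tensor is a coset, that is, a set of formal linear combinations.
\<close>

definition free_scale :: "'k::field \<Rightarrow> ('i \<Rightarrow>\<^sub>0 'k) \<Rightarrow> ('i \<Rightarrow>\<^sub>0 'k)"
  where "free_scale c p = Poly_Mapping.map ((*) c) p"

definition linear_extension ::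
    "('k::field \<Rightarrow> 'v::ab_group_add \<Rightarrow> 'v) \<Rightarrow> ('i \<Rightarrow> 'v) \<Rightarrow> ('i \<Rightarrow>\<^sub>0 'k) \<Rightarrow> 'v"
  where "linear_extension scale f p =
    (\<Sum>i\<in>Poly_Mapping.keys p. scale (Poly_Mapping.lookup p i) (f i))"

definition bilinear_relations ::
    "('k::field \<Rightarrow> 'a::ab_group_add \<Rightarrow> 'a) \<Rightarrow> ('a \<times> 'a \<Rightarrow>\<^sub>0 'k) set"
  where "bilinear_relations scale = module.span free_scale
     ({Poly_Mapping.single (a + a', b) 1 - Poly_Mapping.single (a, b) 1
         - Poly_Mapping.single (a', b) 1 |a a' b. True}
    \<union> {Poly_Mapping.single (a, b + b') 1 - Poly_Mapping.single (a, b) 1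
         - Poly_Mapping.single (a, b') 1 |a b b'. True}
    \<union> {Poly_Mapping.single (scale k a, b) 1 - Poly_Mapping.single (a, b) k |k a b. True}
    \<union> {Poly_Mapping.single (a, scale k b) 1 - Poly_Mapping.single (a, b) k |k a b. True})"

definition trilinear_relations ::
    "('k::field \<Rightarrow> 'a::ab_group_add \<Rightarrow> 'a) \<Rightarrow> ('a \<times> 'a \<times> 'a \<Rightarrow>\<^sub>0 'k) set"
  where "trilinear_relations scale = module.span free_scale
     ({Poly_Mapping.single (a + a', b, c) 1 - Poly_Mapping.single (a, b, c) 1
         - Poly_Mapping.single (a', b, c) 1 |a a' b c. True}
    \<union> {Poly_Mapping.single (a, b + b', c) 1 - Poly_Mapping.single (a, b, c) 1
         - Poly_Mapping.single (a, b', c) 1 |a b b' c. True}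
    \<union> {Poly_Mapping.single (a, b, c + c') 1 - Poly_Mapping.single (a, b, c) 1
         - Poly_Mapping.single (a, b, c') 1 |a b c c'. True}
    \<union> {Poly_Mapping.single (scale k a, b, c) 1 - Poly_Mapping.single (a, b, c) k |k a b c. True}
    \<union> {Poly_Mapping.single (a, scale k b, c) 1 - Poly_Mapping.single (a, b, c) k |k a b c. True}
    \<union> {Poly_Mapping.single (a, b, scale k c) 1 - Poly_Mapping.single (a, b, c) k |k a b c. True})"

definition coset_of :: "'v::ab_group_add set \<Rightarrow> 'v \<Rightarrow> 'v set"
  where "coset_of N p = {q. q - p \<in> N}"

definition coset_add :: "'v::ab_group_add set \<Rightarrow> 'v set \<Rightarrow> 'v set"
  where "coset_add X Y = {p + q |p q. p \<in> X \<and> q \<in> Y}"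

definition coset_diff :: "'v::ab_group_add set \<Rightarrow> 'v set \<Rightarrow> 'v set"
  where "coset_diff X Y = {p - q |p q. p \<in> X \<and> q \<in> Y}"

definition tensor2_class ::
    "('k::field \<Rightarrow> 'a::ab_group_add \<Rightarrow> 'a) \<Rightarrow> ('a \<times> 'a \<Rightarrow>\<^sub>0 'k) \<Rightarrow> ('a \<times> 'a \<Rightarrow>\<^sub>0 'k) set"
  where "tensor2_class scale p = coset_of (bilinear_relations scale) p"

definition tensor3_class ::
    "('k::field \<Rightarrow> 'a::ab_group_add \<Rightarrow> 'a) \<Rightarrow> ('a \<times> 'a \<times> 'a \<Rightarrow>\<^sub>0 'k)
      \<Rightarrow> ('a \<times> 'a \<times> 'a \<Rightarrow>\<^sub>0 'k) set"
  where "tensor3_class scale p = coset_of (trilinear_relations scale) p"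

definition tensor_square ::
    "('k::field \<Rightarrow> 'a::ab_group_add \<Rightarrow> 'a) \<Rightarrow> ('a \<times> 'a \<Rightarrow>\<^sub>0 'k) set set"
  where "tensor_square scale = range (tensor2_class scale)"

text \<open>
  For a bilinear map \<open>f\<close>, the linear extension of \<open>f\<close> is constant on each coset
  (lemma \<open>tensor2_lift_class\<close> below); its value on the coset \<open>t\<close> is the image of \<open>t\<close> under the
  linear map on \<open>A \<otimes> A\<close> induced by \<open>f\<close>. So \<open>tensor2_lift scale f t\<close> is
  \<open>f t\<^sub>(\<^sub>1\<^sub>) t\<^sub>(\<^sub>2\<^sub>)\<close> with summation understood.
\<close>

definition tensor2_lift ::
    "('k::field \<Rightarrow> 'a::ab_group_add \<Rightarrow> 'a) \<Rightarrow> ('a \<Rightarrow> 'a \<Rightarrow> 'a)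
      \<Rightarrow> ('a \<times> 'a \<Rightarrow>\<^sub>0 'k) set \<Rightarrow> 'a"
  where "tensor2_lift scale f t = the_elem (linear_extension scale (\<lambda>(x, y). f x y) ` t)"

text \<open>The endomorphism \<open>f \<otimes> f\<close> of \<open>A \<otimes> A\<close>, for a linear map \<open>f\<close>.\<close>

definition tensor2_map ::
    "('k::field \<Rightarrow> 'a::ab_group_add \<Rightarrow> 'a) \<Rightarrow> ('a \<Rightarrow> 'a)
      \<Rightarrow> ('a \<times> 'a \<Rightarrow>\<^sub>0 'k) set \<Rightarrow> ('a \<times> 'a \<Rightarrow>\<^sub>0 'k) set"
  where "tensor2_map scale f t =
    (\<Union>p\<in>t. tensor2_class scale
      (linear_extension free_scale (\<lambda>(x, y). Poly_Mapping.single (f x, f y) 1) p))"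

text \<open>
  If \<open>f x y u v = (g, h, k)\<close> with \<open>g\<close>, \<open>h\<close>, \<open>k\<close> such that \<open>g \<otimes> h \<otimes> k\<close> is linear in each of
  \<open>x\<close>, \<open>y\<close>, \<open>u\<close>, \<open>v\<close>, then \<open>tensor3_of_pair\<close> is the induced bilinear map
  \<open>(A \<otimes> A) \<times> (A \<otimes> A) \<rightarrow> A \<otimes> A \<otimes> A\<close>, sending \<open>(x \<otimes> y, u \<otimes> v)\<close> to \<open>g \<otimes> h \<otimes> k\<close>.
\<close>

definition tensor3_of_pair ::
    "('k::field \<Rightarrow> 'a::ab_group_add \<Rightarrow> 'a) \<Rightarrow> ('a \<Rightarrow> 'a \<Rightarrow> 'a \<Rightarrow> 'a \<Rightarrow> 'a \<times> 'a \<times> 'a)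
      \<Rightarrow> ('a \<times> 'a \<Rightarrow>\<^sub>0 'k) set \<Rightarrow> ('a \<times> 'a \<Rightarrow>\<^sub>0 'k) set \<Rightarrow> ('a \<times> 'a \<times> 'a \<Rightarrow>\<^sub>0 'k) set"
  where "tensor3_of_pair scale f t w =
    (\<Union>p\<in>t. \<Union>q\<in>w. tensor3_class scale
      (linear_extension free_scale
        (\<lambda>(x, y). linear_extension free_scale (\<lambda>(u, v). Poly_Mapping.single (f x y u v) 1) q) p))"

lemma lookup_free_scale [simp]:
  "Poly_Mapping.lookup (free_scale c p) i = c * Poly_Mapping.lookup p i"
  by (simp add: free_scale_def Poly_Mapping.map.rep_eq when_def)

lemma free_vector_space: "vector_space free_scale"
  by unfold_locales (auto intro!: poly_mapping_eqI simp: lookup_add algebra_simps)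

context vector_space
begin

lemma linear_extension_superset:
  assumes "finite I" "Poly_Mapping.keys p \<subseteq> I"
  shows "linear_extension scale f p = (\<Sum>i\<in>I. scale (Poly_Mapping.lookup p i) (f i))"
  unfolding linear_extension_def
  by (rule sum.mono_neutral_left) (use assms in \<open>auto simp: in_keys_iff\<close>)

lemma linear_extension_linear:
  "Vector_Spaces.linear free_scale scale (linear_extension scale f)"
proof -
  interpret F: vector_space free_scale by (rule free_vector_space)
  show ?thesis
  proof (unfold_locales, goal_cases)
    case (1 p q)
    let ?I = "Poly_Mapping.keys p \<union> Poly_Mapping.keys q"
    have "Poly_Mapping.keys (p + q) \<subseteq> ?I" by (rule keys_add)
    then show ?case
      by (simp add: linear_extension_superset[where I = ?I] lookup_add scale_left_distrib
          sum.distrib)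
  next
    case (2 c p)
    have "Poly_Mapping.keys (free_scale c p) \<subseteq> Poly_Mapping.keys p"
      by (auto simp: in_keys_iff)
    then show ?case
      by (simp add: linear_extension_superset[where I = "Poly_Mapping.keys p"] scale_sum_right)
  qed
qed

lemma linear_extension_single [simp]:
  "linear_extension scale f (Poly_Mapping.single i c) = scale c (f i)"
  by (cases "c = 0") (auto simp: linear_extension_def)

end

lemma free_scale_single [simp]:
  "free_scale c (Poly_Mapping.single i d) = Poly_Mapping.single i (c * d)"
  by (rule poly_mapping_eqI) (simp add: lookup_single when_def)

lemma (in vector_space) linear_extension_bilinear_relations:
  assumes W: "vector_space scaleW"
    and l: "\<And>y. Vector_Spaces.linear scale scaleW (\<lambda>x. f x y)"
    and r: "\<And>x. Vector_Spaces.linear scale scaleW (f x)"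
    and p: "p \<in> bilinear_relations scale"
  shows "linear_extension scaleW (\<lambda>(x, y). f x y) p = 0"
proof -
  interpret F: vector_space "free_scale :: _ \<Rightarrow> ('b \<times> 'b \<Rightarrow>\<^sub>0 'a) \<Rightarrow> _" by (rule free_vector_space)
  interpret W: vector_space scaleW by (rule W)
  interpret E: Vector_Spaces.linear free_scale scaleW "linear_extension scaleW (\<lambda>(x, y). f x y)"
    by (rule W.linear_extension_linear)
  have l': "f (a + b) y = f a y + f b y" "f (scale c a) y = scaleW c (f a y)" for a b c y
    using Vector_Spaces.linear.axioms(3)[OF l] by (auto simp: module_hom_def module_hom_axioms_def)
  have r': "f y (a + b) = f y a + f y b" "f y (scale c a) = scaleW c (f y a)" for a b c y
    using Vector_Spaces.linear.axioms(3)[OF r] by (auto simp: module_hom_def module_hom_axioms_def)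
  show ?thesis
    using p unfolding bilinear_relations_def
    by (rule E.eq_0_on_span[rotated]) (auto simp: E.diff l' r')
qed

lemma (in vector_space) tensor2_lift_class:
  assumes "\<And>y. Vector_Spaces.linear scale scale (\<lambda>x. f x y)"
    and "\<And>x. Vector_Spaces.linear scale scale (f x)"
  shows "tensor2_lift scale f (tensor2_class scale p) = linear_extension scale (\<lambda>(x, y). f x y) p"
proof -
  interpret F: vector_space "free_scale :: _ \<Rightarrow> ('b \<times> 'b \<Rightarrow>\<^sub>0 'a) \<Rightarrow> _" by (rule free_vector_space)
  interpret E: Vector_Spaces.linear free_scale scale "linear_extension scale (\<lambda>(x, y). f x y)"
    by (rule linear_extension_linear)
  have "linear_extension scale (\<lambda>(x, y). f x y) q = linear_extension scale (\<lambda>(x, y). f x y) p"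
    if "q - p \<in> bilinear_relations scale" for q
    using linear_extension_bilinear_relations[OF vector_space_axioms assms that] by (simp add: E.diff)
  moreover have "p - p \<in> bilinear_relations scale"
    by (simp add: bilinear_relations_def F.span_zero)
  ultimately have "linear_extension scale (\<lambda>(x, y). f x y) ` tensor2_class scale p
      = {linear_extension scale (\<lambda>(x, y). f x y) p}"
    unfolding tensor2_class_def coset_of_def by blast
  then show ?thesis by (simp add: tensor2_lift_def)
qed


section \<open>Hom-associative algebras, Hom-Yang-Baxter pairs and Rota-Baxter systems\<close>

text \<open>The structure is multiplicative: \<open>alpha\<close> is an endomorphism for the product.\<close>

locale hom_associative_algebra = vector_space scale
  for scale :: "'k::field \<Rightarrow> 'a::ab_group_add \<Rightarrow> 'a" +
  fixes alpha :: "'a \<Rightarrow> 'a"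
    and mu :: "'a \<Rightarrow> 'a \<Rightarrow> 'a" (infixl "\<cdot>" 70)
  assumes alpha_linear: "Vector_Spaces.linear scale scale alpha"
    and mu_linear_left: "\<And>b. Vector_Spaces.linear scale scale (\<lambda>a. a \<cdot> b)"
    and mu_linear_right: "\<And>a. Vector_Spaces.linear scale scale (\<lambda>b. a \<cdot> b)"
    and hom_assoc: "\<And>a b c. (a \<cdot> b) \<cdot> alpha c = alpha a \<cdot> (b \<cdot> c)"
    and alpha_mult: "\<And>a b. alpha (a \<cdot> b) = alpha a \<cdot> alpha b"
begin

definition alpha_invariant :: "('a \<times> 'a \<Rightarrow>\<^sub>0 'k) set \<Rightarrow> bool"
  where "alpha_invariant t \<longleftrightarrow> tensor2_map scale alpha t = t"

text \<open>
  \<open>prod_13_12 t w\<close> is \<open>t\<^sub>1\<^sub>3 w\<^sub>1\<^sub>2\<close>, and similarly for the other two; the first tensor argument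
  is \<open>x \<otimes> y\<close> and the second one is \<open>u \<otimes> v\<close>.
\<close>

definition prod_13_12 ::
    "('a \<times> 'a \<Rightarrow>\<^sub>0 'k) set \<Rightarrow> ('a \<times> 'a \<Rightarrow>\<^sub>0 'k) set \<Rightarrow> ('a \<times> 'a \<times> 'a \<Rightarrow>\<^sub>0 'k) set"
  where "prod_13_12 = tensor3_of_pair scale (\<lambda>x y u v. (x \<cdot> u, alpha v, alpha y))"

definition prod_12_23 ::
    "('a \<times> 'a \<Rightarrow>\<^sub>0 'k) set \<Rightarrow> ('a \<times> 'a \<Rightarrow>\<^sub>0 'k) set \<Rightarrow> ('a \<times> 'a \<times> 'a \<Rightarrow>\<^sub>0 'k) set"
  where "prod_12_23 = tensor3_of_pair scale (\<lambda>x y u v. (alpha x, y \<cdot> u, alpha v))"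

definition prod_23_13 ::
    "('a \<times> 'a \<Rightarrow>\<^sub>0 'k) set \<Rightarrow> ('a \<times> 'a \<Rightarrow>\<^sub>0 'k) set \<Rightarrow> ('a \<times> 'a \<times> 'a \<Rightarrow>\<^sub>0 'k) set"
  where "prod_23_13 = tensor3_of_pair scale (\<lambda>x y u v. (alpha u, alpha x, y \<cdot> v))"

definition hom_yang_baxter_pair ::
    "('a \<times> 'a \<Rightarrow>\<^sub>0 'k) set \<Rightarrow> ('a \<times> 'a \<Rightarrow>\<^sub>0 'k) set \<Rightarrow> bool"
  where "hom_yang_baxter_pair r s \<longleftrightarrow>
    r \<in> tensor_square scale \<and> s \<in> tensor_square scale \<and>
    alpha_invariant r \<and> alpha_invariant s \<and>
    coset_add (coset_diff (prod_13_12 r r) (prod_12_23 r r)) (prod_23_13 s r)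
      = tensor3_class scale 0 \<and>
    coset_add (coset_diff (prod_13_12 s r) (prod_12_23 s s)) (prod_23_13 s s)
      = tensor3_class scale 0"

definition rota_baxter_system :: "nat \<Rightarrow> ('a \<Rightarrow> 'a) \<Rightarrow> ('a \<Rightarrow> 'a) \<Rightarrow> bool"
  where "rota_baxter_system n R S \<longleftrightarrow>
    Vector_Spaces.linear scale scale R \<and> Vector_Spaces.linear scale scale S \<and>
    alpha \<circ> R = R \<circ> alpha \<and> alpha \<circ> S = S \<circ> alpha \<and>
    (\<forall>a b. R ((alpha ^^ n) a) \<cdot> R ((alpha ^^ n) b)
         = R (R a \<cdot> (alpha ^^ n) b + (alpha ^^ n) a \<cdot> S b)) \<and>
    (\<forall>a b. S ((alpha ^^ n) a) \<cdot> S ((alpha ^^ n) b)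
         = S (R a \<cdot> (alpha ^^ n) b + (alpha ^^ n) a \<cdot> S b))"

end

end

theory Submission
  imports Defs
begin

text \<open>
  For fixed \<open>a\<close> and \<open>b\<close>, the trilinear map
  \<open>T p q w = (\<alpha> p \<cdot> \<alpha>\<^sup>3 a) \<cdot> (\<alpha> q \<cdot> (\<alpha>\<^sup>2 b \<cdot> w))\<close> is applied to the two Hom-Yang-Baxter equations.
  By \<open>\<alpha>\<close>-invariance, copies of \<open>\<alpha>\<close> may be inserted in both legs of \<open>r\<close> or of \<open>s\<close> at will, and with
  the right number of copies Hom-associativity turns the three terms of the first equation into
  \<open>R (R a \<cdot> \<alpha>\<^sup>2 b)\<close>, \<open>R (\<alpha>\<^sup>2 a) \<cdot> R (\<alpha>\<^sup>2 b)\<close> and \<open>R (\<alpha>\<^sup>2 a \<cdot> S b)\<close>, and those of the second one into the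
  same expressions with the outer \<open>R\<close> replaced by \<open>S\<close>.
\<close>

section \<open>Evaluation of multilinear maps on representatives of tensors\<close>

definition bilinear_map :: "('k::field \<Rightarrow> 'a::ab_group_add \<Rightarrow> 'a) \<Rightarrow> ('a \<Rightarrow> 'a \<Rightarrow> 'a) \<Rightarrow> bool"
  where "bilinear_map scale f \<longleftrightarrow>
    (\<forall>y. Vector_Spaces.linear scale scale (\<lambda>x. f x y)) \<and>
    (\<forall>x. Vector_Spaces.linear scale scale (f x))"

text \<open>Evaluation on a chosen representative \<open>p\<close> of a tensor. Being a finite sum,
  it can be added, scaled and nested for arbitrary \<open>f\<close>; bilinearity enters only when
  the representative changes.\<close>

definition formal_sum ::
    "('k::field \<Rightarrow> 'a::ab_group_add \<Rightarrow> 'a) \<Rightarrow> ('a \<times> 'a \<Rightarrow>\<^sub>0 'k) \<Rightarrow> ('a \<Rightarrow> 'a \<Rightarrow> 'a) \<Rightarrow> 'a"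
  where "formal_sum scale p f = linear_extension scale (\<lambda>(x, y). f x y) p"

text \<open>The representative that \<open>tensor3_of_pair\<close> assigns to the representatives
  \<open>p\<close> and \<open>q\<close> of its two arguments.\<close>

definition formal_triple ::
    "('a \<Rightarrow> 'a \<Rightarrow> 'a \<Rightarrow> 'a \<Rightarrow> 'a \<times> 'a \<times> 'a)
      \<Rightarrow> ('a \<times> 'a \<Rightarrow>\<^sub>0 'k::field) \<Rightarrow> ('a \<times> 'a \<Rightarrow>\<^sub>0 'k) \<Rightarrow> ('a \<times> 'a \<times> 'a \<Rightarrow>\<^sub>0 'k)"
  where "formal_triple f p q = linear_extension free_scale
    (\<lambda>(x, y). linear_extension free_scale (\<lambda>(u, v). Poly_Mapping.single (f x y u v) 1) q) p"

context vector_space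
begin

lemma linear_self_iff:
  "Vector_Spaces.linear scale scale f \<longleftrightarrow>
    (\<forall>x y. f (x + y) = f x + f y) \<and> (\<forall>c x. f (scale c x) = scale c (f x))"
  by (auto simp: Vector_Spaces.linear_iff intro: vector_space_axioms)

lemma bilinear_map_iff:
  "bilinear_map scale f \<longleftrightarrow>
    (\<forall>x x' y. f (x + x') y = f x y + f x' y) \<and> (\<forall>c x y. f (scale c x) y = scale c (f x y)) \<and>
    (\<forall>x y y'. f x (y + y') = f x y + f x y') \<and> (\<forall>c x y. f x (scale c y) = scale c (f x y))"
  by (auto simp: bilinear_map_def linear_self_iff)

lemma formal_sum_add: "formal_sum scale p (\<lambda>x y. f x y + g x y) = formal_sum scale p f + formal_sum scale p g"
  by (simp add: formal_sum_def linear_extension_def scale_right_distrib sum.distrib split_def)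

lemma formal_sum_scale: "formal_sum scale p (\<lambda>x y. scale c (f x y)) = scale c (formal_sum scale p f)"
  by (simp add: formal_sum_def linear_extension_def scale_sum_right split_def mult.commute)

lemma linear_formal_sum:
  assumes "Vector_Spaces.linear scale scale h"
  shows "h (formal_sum scale p f) = formal_sum scale p (\<lambda>x y. h (f x y))"
proof -
  interpret H: Vector_Spaces.linear scale scale h by (rule assms)
  show ?thesis
    by (simp add: formal_sum_def linear_extension_def H.sum H.scale split_def)
qed

text \<open>Two representatives of a tensor differ by bilinear relations, and a bilinear map kills
  these; so any member of the coset computes the lift.\<close>

lemma tensor2_lift_eq_formal_sum:
  assumes "t \<in> tensor_square scale" "p \<in> t" "bilinear_map scale f"
  shows "tensor2_lift scale f t = formal_sum scale p f"
proof -
  interpret F: vector_space "free_scale :: _ \<Rightarrow> ('b \<times> 'b \<Rightarrow>\<^sub>0 'a) \<Rightarrow> _" by (rule free_vector_space)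
  interpret E: Vector_Spaces.linear free_scale scale "linear_extension scale (\<lambda>(x, y). f x y)"
    by (rule linear_extension_linear)
  obtain q where q: "t = tensor2_class scale q"
    using assms(1) by (auto simp: tensor_square_def)
  then have "p - q \<in> bilinear_relations scale"
    using assms(2) by (simp add: tensor2_class_def coset_of_def)
  then have "linear_extension scale (\<lambda>(x, y). f x y) (p - q) = 0"
    using assms(3) by (intro linear_extension_bilinear_relations vector_space_axioms)
      (auto simp: bilinear_map_def)
  then show ?thesis
    using assms(3) by (simp add: q tensor2_lift_class bilinear_map_def formal_sum_def E.diff)
qed

lemma tensor2_class_refl: "p \<in> tensor2_class scale p"
proof -
  interpret F: vector_space "free_scale :: _ \<Rightarrow> ('b \<times> 'b \<Rightarrow>\<^sub>0 'a) \<Rightarrow> _" by (rule free_vector_space)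
  show ?thesis
    by (simp add: tensor2_class_def coset_of_def bilinear_relations_def F.span_zero)
qed

lemma tensor3_class_refl: "p \<in> tensor3_class scale p"
proof -
  interpret F: vector_space "free_scale :: _ \<Rightarrow> ('b \<times> 'b \<times> 'b \<Rightarrow>\<^sub>0 'a) \<Rightarrow> _"
    by (rule free_vector_space)
  show ?thesis
    by (simp add: tensor3_class_def coset_of_def trilinear_relations_def F.span_zero)
qed

text \<open>Turns evaluation on a nested formal combination, as in \<open>tensor2_map\<close> and
  \<open>tensor3_of_pair\<close>, into an iterated sum.\<close>

lemma linear_extension_linear_extension:
  "linear_extension scale g (linear_extension free_scale f p)
    = linear_extension scale (\<lambda>i. linear_extension scale g (f i)) p"
proof -
  interpret E: Vector_Spaces.linear free_scale scale "linear_extension scale g"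
    by (rule linear_extension_linear)
  show ?thesis
    by (simp add: linear_extension_def[of free_scale] E.sum E.scale)
       (simp add: linear_extension_def)
qed

lemma formal_sum_tensor2_map:
  "formal_sum scale (linear_extension free_scale (\<lambda>(x, y). Poly_Mapping.single (h x, h y) 1) p) f
    = formal_sum scale p (\<lambda>x y. f (h x) (h y))"
  by (simp add: formal_sum_def linear_extension_linear_extension split_def)

lemma linear_extension_trilinear_relations:
  assumes "\<And>y z. Vector_Spaces.linear scale scale (\<lambda>x. f x y z)"
    and "\<And>x z. Vector_Spaces.linear scale scale (\<lambda>y. f x y z)"
    and "\<And>x y. Vector_Spaces.linear scale scale (f x y)"
    and p: "p \<in> trilinear_relations scale"
  shows "linear_extension scale (\<lambda>(x, y, z). f x y z) p = 0"
proof -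
  interpret F: vector_space "free_scale :: _ \<Rightarrow> ('b \<times> 'b \<times> 'b \<Rightarrow>\<^sub>0 'a) \<Rightarrow> _"
    by (rule free_vector_space)
  interpret E: Vector_Spaces.linear free_scale scale "linear_extension scale (\<lambda>(x, y, z). f x y z)"
    by (rule linear_extension_linear)
  show ?thesis
    using p unfolding trilinear_relations_def
    by (rule E.eq_0_on_span[rotated]) (use assms(1-3) in \<open>auto simp: E.diff linear_self_iff\<close>)
qed

lemma formal_triple_mem:
  assumes "p \<in> t" "q \<in> w"
  shows "formal_triple f p q \<in> tensor3_of_pair scale f t w"
  using assms tensor3_class_refl unfolding tensor3_of_pair_def formal_triple_def by blast

lemma linear_extension_formal_triple:
  "linear_extension scale g (formal_triple f p q)
    = formal_sum scale p (\<lambda>x y. formal_sum scale q (\<lambda>u v. g (f x y u v)))"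
  by (simp add: formal_triple_def formal_sum_def linear_extension_linear_extension split_def)

text \<open>Carries an identity of cosets in the tensor cube over to the algebra:
  \<open>p - q + u\<close> is a trilinear relation, hence is killed by the trilinear map.\<close>

lemma trilinear_map_coset_sum:
  assumes "\<And>y z. Vector_Spaces.linear scale scale (\<lambda>x. f x y z)"
    and "\<And>x z. Vector_Spaces.linear scale scale (\<lambda>y. f x y z)"
    and "\<And>x y. Vector_Spaces.linear scale scale (f x y)"
    and eq: "coset_add (coset_diff X Y) Z = tensor3_class scale 0"
    and mem: "p \<in> X" "q \<in> Y" "u \<in> Z"
  shows "linear_extension scale (\<lambda>(x, y, z). f x y z) p + linear_extension scale (\<lambda>(x, y, z). f x y z) u
    = linear_extension scale (\<lambda>(x, y, z). f x y z) q"
proof -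
  interpret E: Vector_Spaces.linear free_scale scale "linear_extension scale (\<lambda>(x, y, z). f x y z)"
    by (rule linear_extension_linear)
  have "p - q + u \<in> coset_add (coset_diff X Y) Z"
    using mem unfolding coset_add_def coset_diff_def by blast
  then have "p - q + u \<in> trilinear_relations scale"
    by (simp add: eq tensor3_class_def coset_of_def)
  from linear_extension_trilinear_relations[OF assms(1-3) this] show ?thesis
    by (simp add: E.add E.diff algebra_simps)
qed

end

section \<open>Invariant tensors and the operators they define\<close>

context hom_associative_algebra
begin

lemma alpha_add: "alpha (a + b) = alpha a + alpha b"
  and alpha_scale: "alpha (scale c a) = scale c (alpha a)"
  using alpha_linear by (auto simp: linear_self_iff)

lemma mu_add_left: "(a + b) \<cdot> d = a \<cdot> d + b \<cdot> d"
  and mu_scale_left: "scale c a \<cdot> d = scale c (a \<cdot> d)"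
  using mu_linear_left by (auto simp: linear_self_iff)

lemma mu_add_right: "d \<cdot> (a + b) = d \<cdot> a + d \<cdot> b"
  and mu_scale_right: "d \<cdot> scale c a = scale c (d \<cdot> a)"
  using mu_linear_right by (auto simp: linear_self_iff)

lemmas multilinear_simps = linear_self_iff bilinear_map_iff alpha_add alpha_scale
  mu_add_left mu_scale_left mu_add_right mu_scale_right formal_sum_add formal_sum_scale

text \<open>What \<alpha>-invariance of a tensor means for one representative: \<alpha> \<otimes>
  \<alpha> may change \<open>p\<close>, but only by relations, which bilinear maps do not
  see.\<close>

definition invariant_formal_sum :: "('a \<times> 'a \<Rightarrow>\<^sub>0 'k) \<Rightarrow> bool"
  where "invariant_formal_sum p \<longleftrightarrow>
    (\<forall>f. bilinear_map scale f \<longrightarrow> formal_sum scale p (\<lambda>x y. f (alpha x) (alpha y)) = formal_sum scale p f)"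

lemma invariant_formal_sumD:
  assumes "invariant_formal_sum p" "bilinear_map scale f"
  shows "formal_sum scale p f = formal_sum scale p (\<lambda>x y. f (alpha x) (alpha y))"
  using assms by (simp add: invariant_formal_sum_def)

text \<open>The image of \<open>p\<close> under \<alpha> \<otimes> \<alpha> is again a
  representative of \<open>t\<close>, so bilinear maps take the same value on both.\<close>

lemma alpha_invariant_formal_sum:
  assumes "t \<in> tensor_square scale" "alpha_invariant t" "p \<in> t"
  shows "invariant_formal_sum p"
  unfolding invariant_formal_sum_def
proof (intro allI impI)
  fix f assume f: "bilinear_map scale f"
  let ?q = "linear_extension free_scale (\<lambda>(x, y). Poly_Mapping.single (alpha x, alpha y) 1) p"
  have "?q \<in> tensor2_map scale alpha t"
    using \<open>p \<in> t\<close> tensor2_class_refl unfolding tensor2_map_def by blast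
  then have "?q \<in> t"
    using \<open>alpha_invariant t\<close> by (simp add: alpha_invariant_def)
  then have "formal_sum scale ?q f = formal_sum scale p f"
    using assms f by (metis tensor2_lift_eq_formal_sum)
  then show "formal_sum scale p (\<lambda>x y. f (alpha x) (alpha y)) = formal_sum scale p f"
    by (simp add: formal_sum_tensor2_map)
qed

text \<open>This is \<open>R\<close> for every representative of \<open>r\<close>, and
  \<open>S\<close> for every representative of \<open>s\<close>.\<close>

definition baxter_operator :: "('a \<times> 'a \<Rightarrow>\<^sub>0 'k) \<Rightarrow> 'a \<Rightarrow> 'a"
  where "baxter_operator p a = formal_sum scale p (\<lambda>x y. (x \<cdot> a) \<cdot> alpha y)"

lemma baxter_operator_alt: "baxter_operator p a = formal_sum scale p (\<lambda>x y. alpha x \<cdot> (a \<cdot> y))"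
  by (simp add: baxter_operator_def hom_assoc)

lemma baxter_operator_linear: "Vector_Spaces.linear scale scale (baxter_operator p)"
  by (simp add: baxter_operator_def multilinear_simps)

text \<open>Multiplicativity spreads \<alpha> over all factors, and invariance removes it again from
  the two legs.\<close>

lemma baxter_operator_alpha:
  assumes "invariant_formal_sum p"
  shows "alpha (baxter_operator p a) = baxter_operator p (alpha a)"
proof -
  have "alpha (baxter_operator p a)
      = formal_sum scale p (\<lambda>x y. (alpha x \<cdot> alpha a) \<cdot> alpha (alpha y))"
    by (simp add: baxter_operator_def linear_formal_sum[OF alpha_linear] alpha_mult)
  also have "\<dots> = baxter_operator p (alpha a)"
    unfolding baxter_operator_def
    by (rule invariant_formal_sumD[OF assms, symmetric]) (simp add: multilinear_simps)
  finally show ?thesis .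
qed

lemma baxter_operator_alpha_power:
  assumes "invariant_formal_sum p"
  shows "baxter_operator p a
    = formal_sum scale p (\<lambda>x y. ((alpha ^^ n) x \<cdot> a) \<cdot> alpha ((alpha ^^ n) y))"
proof (induction n)
  case 0
  show ?case by (simp add: baxter_operator_def)
next
  case (Suc n)
  have lin: "(alpha ^^ n) (x + y) = (alpha ^^ n) x + (alpha ^^ n) y"
    "(alpha ^^ n) (scale c x) = scale c ((alpha ^^ n) x)" for x y c
    by (induction n) (simp_all add: alpha_add alpha_scale)
  have "baxter_operator p a
      = formal_sum scale p (\<lambda>x y. ((alpha ^^ n) (alpha x) \<cdot> a) \<cdot> alpha ((alpha ^^ n) (alpha y)))"
    unfolding Suc by (rule invariant_formal_sumD[OF assms]) (simp add: multilinear_simps lin)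
  then show ?case by (simp add: funpow_swap1)
qed

section \<open>Evaluation of the three products in the Hom-Yang-Baxter equations\<close>

definition trilinear_test :: "'a \<Rightarrow> 'a \<Rightarrow> 'a \<Rightarrow> 'a \<Rightarrow> 'a \<Rightarrow> 'a"
  where "trilinear_test a b p q w =
    (alpha p \<cdot> alpha (alpha (alpha a))) \<cdot> (alpha q \<cdot> (alpha (alpha b) \<cdot> w))"

lemma trilinear_test_13_12:
  assumes p: "invariant_formal_sum p" and q: "invariant_formal_sum q"
  shows "formal_sum scale p (\<lambda>x y. formal_sum scale q
      (\<lambda>u v. trilinear_test a b (x \<cdot> u) (alpha v) (alpha y)))
    = baxter_operator p (baxter_operator q a \<cdot> alpha (alpha b))" (is "?l = _")
proof -
  let ?c = "baxter_operator q a \<cdot> alpha (alpha b)"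
  \<comment> \<open>Hom-associativity rewrites the two outer factors as \<open>\<alpha>\<^sup>3 x
    \<cdot> (\<alpha>\<^sup>2 u \<cdot> \<alpha>\<^sup>2 a)\<close> and \<open>(\<alpha>\<^sup>2 v
    \<cdot> \<alpha>\<^sup>2 b) \<cdot> \<alpha>\<^sup>3 y\<close>; two more uses collect everything
    between \<open>x\<close> and \<open>y\<close>.\<close>
  have test: "trilinear_test a b (alpha x \<cdot> alpha u) (alpha (alpha v)) (alpha (alpha y))
      = (alpha (alpha (alpha x)) \<cdot> ((alpha u \<cdot> alpha a) \<cdot> (alpha v \<cdot> alpha b)))
         \<cdot> alpha (alpha (alpha (alpha y)))" for x y u v
    by (metis trilinear_test_def alpha_mult hom_assoc)
  have "((u \<cdot> a) \<cdot> alpha v) \<cdot> alpha (alpha b) = (alpha u \<cdot> alpha a) \<cdot> (alpha v \<cdot> alpha b)" for u v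
    by (metis alpha_mult hom_assoc)
  then have c: "?c = formal_sum scale q (\<lambda>u v. (alpha u \<cdot> alpha a) \<cdot> (alpha v \<cdot> alpha b))"
    by (simp add: baxter_operator_def linear_formal_sum[OF mu_linear_left])
  have "?l = formal_sum scale p (\<lambda>x y. formal_sum scale q
      (\<lambda>u v. trilinear_test a b (alpha x \<cdot> u) (alpha v) (alpha (alpha y))))"
    by (rule invariant_formal_sumD[OF p]) (simp add: trilinear_test_def multilinear_simps)
  also have "\<dots> = formal_sum scale p (\<lambda>x y. formal_sum scale q
      (\<lambda>u v. trilinear_test a b (alpha x \<cdot> alpha u) (alpha (alpha v)) (alpha (alpha y))))"
    by (subst invariant_formal_sumD[OF q]) (simp_all add: trilinear_test_def multilinear_simps)
  also have "\<dots> = formal_sum scale p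
      (\<lambda>x y. (alpha (alpha (alpha x)) \<cdot> ?c) \<cdot> alpha (alpha (alpha (alpha y))))"
    unfolding test c
    by (simp add: linear_formal_sum[OF mu_linear_left] linear_formal_sum[OF mu_linear_right])
  \<comment> \<open>Compared with the defining sum, both legs carry three extra copies of
    \<alpha>.\<close>
  also have "\<dots> = baxter_operator p ?c"
    by (subst baxter_operator_alpha_power[OF p, where n = 3]) (simp add: numeral_3_eq_3)
  finally show ?thesis .
qed

lemma trilinear_test_12_23:
  assumes p: "invariant_formal_sum p" and q: "invariant_formal_sum q"
  shows "formal_sum scale p (\<lambda>x y. formal_sum scale q
      (\<lambda>u v. trilinear_test a b (alpha x) (y \<cdot> u) (alpha v)))
    = baxter_operator p (alpha (alpha a)) \<cdot> baxter_operator q (alpha (alpha b))" (is "?l = _")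
proof -
  let ?a = "alpha (alpha a)" and ?b = "alpha (alpha b)"
  \<comment> \<open>The middle factor \<open>\<alpha> (y \<cdot> u)\<close> is split:
    \<open>y\<close> joins the first factor and \<open>u\<close> the last, which separates the sums
    over \<open>p\<close> and \<open>q\<close>.\<close>
  have test: "trilinear_test a b (alpha x) (y \<cdot> u) (alpha v)
      = ((alpha x \<cdot> ?a) \<cdot> alpha (alpha y)) \<cdot> (alpha (alpha u) \<cdot> (?b \<cdot> alpha v))" for x y u v
    by (metis trilinear_test_def alpha_mult hom_assoc)
  have op_p: "baxter_operator p ?a = formal_sum scale p (\<lambda>x y. (alpha x \<cdot> ?a) \<cdot> alpha (alpha y))"
    unfolding baxter_operator_def
    by (rule invariant_formal_sumD[OF p]) (simp add: multilinear_simps)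
  have op_q: "baxter_operator q ?b = formal_sum scale q (\<lambda>u v. alpha (alpha u) \<cdot> (?b \<cdot> alpha v))"
    unfolding baxter_operator_alt
    by (rule invariant_formal_sumD[OF q]) (simp add: multilinear_simps)
  have "?l = formal_sum scale p (\<lambda>x y. ((alpha x \<cdot> ?a) \<cdot> alpha (alpha y)) \<cdot> baxter_operator q ?b)"
    unfolding test op_q by (simp add: linear_formal_sum[OF mu_linear_right])
  also have "\<dots> = baxter_operator p ?a \<cdot> baxter_operator q ?b"
    unfolding op_p by (simp add: linear_formal_sum[OF mu_linear_left])
  finally show ?thesis .
qed

text \<open>The outer operator belongs to the tensor in legs 1 and 3, because the test map places
  these legs at its two ends. Here that tensor is the second one.\<close>

lemma trilinear_test_23_13:
  assumes p: "invariant_formal_sum p" and q: "invariant_formal_sum q"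
  shows "formal_sum scale p (\<lambda>x y. formal_sum scale q
      (\<lambda>u v. trilinear_test a b (alpha u) (alpha x) (y \<cdot> v)))
    = baxter_operator q (alpha (alpha a) \<cdot> baxter_operator p b)" (is "?l = _")
proof -
  \<comment> \<open>With \<open>z = \<alpha> x \<cdot> (b \<cdot> y)\<close>, the left side is
    \<open>(\<alpha>\<^sup>2 u \<cdot> \<alpha>\<^sup>3 a) \<cdot> (\<alpha> z \<cdot>
    \<alpha>\<^sup>2 v)\<close>. The \<alpha> inserted on \<open>y\<close> makes the factor
    \<open>\<alpha> z\<close> appear.\<close>
  have test: "trilinear_test a b (alpha u) (alpha (alpha x)) (alpha y \<cdot> v)
      = (alpha (alpha u) \<cdot> (alpha (alpha a) \<cdot> (alpha x \<cdot> (b \<cdot> y)))) \<cdot> alpha (alpha (alpha v))"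
    for x y u v
    by (metis trilinear_test_def alpha_mult hom_assoc)
  have op_q: "baxter_operator q c
      = formal_sum scale q (\<lambda>u v. (alpha (alpha u) \<cdot> c) \<cdot> alpha (alpha (alpha v)))" for c
    by (subst baxter_operator_alpha_power[OF q, where n = 2]) (simp add: numeral_2_eq_2)
  have "?l = formal_sum scale p (\<lambda>x y. formal_sum scale q
      (\<lambda>u v. trilinear_test a b (alpha u) (alpha (alpha x)) (alpha y \<cdot> v)))"
    by (rule invariant_formal_sumD[OF p]) (simp add: trilinear_test_def multilinear_simps)
  also have "\<dots> = formal_sum scale p
      (\<lambda>x y. baxter_operator q (alpha (alpha a) \<cdot> (alpha x \<cdot> (b \<cdot> y))))"
    unfolding test op_q ..
  also have "\<dots> = baxter_operator q (alpha (alpha a) \<cdot> baxter_operator p b)"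
    by (simp add: baxter_operator_alt[of p] linear_formal_sum[OF mu_linear_right]
        linear_formal_sum[OF baxter_operator_linear])
  finally show ?thesis .
qed

text \<open>One statement for both equations: each has the form \<open>t\<^sub>1\<^sub>3
  w\<^sub>1\<^sub>2 - t\<^sub>1\<^sub>2 t\<^sub>2\<^sub>3 + w'\<^sub>2\<^sub>3
  t\<^sub>1\<^sub>3\<close> with \<open>w = r\<close> and \<open>w' = s\<close>, where
  \<open>t\<close> is \<open>r\<close> in the first and \<open>s\<close> in the second.\<close>

lemma baxter_operator_product:
  assumes inv: "invariant_formal_sum p" "invariant_formal_sum q" "invariant_formal_sum p'"
    and eq: "coset_add (coset_diff (prod_13_12 t w) (prod_12_23 t t)) (prod_23_13 w' t)
      = tensor3_class scale 0"
    and mem: "p \<in> t" "q \<in> w" "p' \<in> w'"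
  shows "baxter_operator p ((alpha ^^ 2) a) \<cdot> baxter_operator p ((alpha ^^ 2) b)
    = baxter_operator p (baxter_operator q a \<cdot> (alpha ^^ 2) b + (alpha ^^ 2) a \<cdot> baxter_operator p' b)"
proof -
  \<comment> \<open>The premises left open say that the test map is linear in each argument;
    unfolding it settles them.\<close>
  note trilinear_map_coset_sum[where f = "trilinear_test a b", OF _ _ _
      eq[unfolded prod_13_12_def prod_12_23_def prod_23_13_def]
      formal_triple_mem[OF mem(1,2)] formal_triple_mem[OF mem(1,1)] formal_triple_mem[OF mem(3,1)]]
  then have "baxter_operator p (baxter_operator q a \<cdot> alpha (alpha b))
      + baxter_operator p (alpha (alpha a) \<cdot> baxter_operator p' b)
      = baxter_operator p (alpha (alpha a)) \<cdot> baxter_operator p (alpha (alpha b))"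
    by (simp add: linear_extension_formal_triple trilinear_test_13_12 trilinear_test_12_23
        trilinear_test_23_13 inv) (simp add: trilinear_test_def multilinear_simps)
  then show ?thesis
    using baxter_operator_linear[of p] by (simp add: numeral_2_eq_2 linear_self_iff)
qed

end

theorem theorem4p4:
  fixes scale :: "'k::field \<Rightarrow> 'a::ab_group_add \<Rightarrow> 'a"
    and alpha :: "'a \<Rightarrow> 'a"
    and mu :: "'a \<Rightarrow> 'a \<Rightarrow> 'a" (infixl "\<cdot>" 70)
    and r s :: "('a \<times> 'a \<Rightarrow>\<^sub>0 'k) set"
    and R S :: "'a \<Rightarrow> 'a"
  assumes "hom_associative_algebra scale alpha (\<cdot>)"
    and "hom_associative_algebra.hom_yang_baxter_pair scale alpha (\<cdot>) r s"
    and "\<And>a. R a = tensor2_lift scale (\<lambda>x y. (x \<cdot> a) \<cdot> alpha y) r"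
    and "\<And>a. S a = tensor2_lift scale (\<lambda>x y. (x \<cdot> a) \<cdot> alpha y) s"
  shows "(\<forall>a. R a = tensor2_lift scale (\<lambda>x y. alpha x \<cdot> (a \<cdot> y)) r) \<and>
    (\<forall>a. S a = tensor2_lift scale (\<lambda>x y. alpha x \<cdot> (a \<cdot> y)) s) \<and>
    hom_associative_algebra.rota_baxter_system scale alpha (\<cdot>) 2 R S"
proof -
  interpret hom_associative_algebra scale alpha "(\<cdot>)" by (rule assms(1))
  from assms(2) have r: "r \<in> tensor_square scale" "alpha_invariant r"
    and s: "s \<in> tensor_square scale" "alpha_invariant s"
    and eq_r: "coset_add (coset_diff (prod_13_12 r r) (prod_12_23 r r)) (prod_23_13 s r)
      = tensor3_class scale 0"
    and eq_s: "coset_add (coset_diff (prod_13_12 s r) (prod_12_23 s s)) (prod_23_13 s s)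
      = tensor3_class scale 0"
    by (simp_all add: hom_yang_baxter_pair_def)
  \<comment> \<open>Fixing one representative of each tensor turns \<open>R\<close> and
    \<open>S\<close> into the operators studied above; the choice is immaterial because the maps
    evaluated are bilinear.\<close>
  obtain p q where p: "p \<in> r" and q: "q \<in> s"
    using r(1) s(1) tensor2_class_refl by (auto simp: tensor_square_def)
  have inv: "invariant_formal_sum p" "invariant_formal_sum q"
    using alpha_invariant_formal_sum r s p q by blast+
  have bil: "bilinear_map scale (\<lambda>x y. (x \<cdot> a) \<cdot> alpha y)" for a
    by (simp add: multilinear_simps)
  have R: "R = baxter_operator p" and S: "S = baxter_operator q"
    using tensor2_lift_eq_formal_sum[OF r(1) p bil] tensor2_lift_eq_formal_sum[OF s(1) q bil]
    by (auto simp: assms(3,4) baxter_operator_def)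
  have "rota_baxter_system 2 R S"
    unfolding rota_baxter_system_def R S
    using baxter_operator_linear baxter_operator_alpha[OF inv(1)] baxter_operator_alpha[OF inv(2)]
      baxter_operator_product[OF inv(1,1,2) eq_r p p q]
      baxter_operator_product[OF inv(2,1,2) eq_s q p q]
    by (simp add: fun_eq_iff)
  then show ?thesis
    by (simp add: assms(3,4) hom_assoc)
qed

end
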